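(* Let $K\in\{\mathbb{R},\mathbb{C}\}$, let $A$ be a unitary algebra over $K$ with basis $\{e_0=1,e_1,\dots,e_n\}$, and for $m\in\mathbb{N}$ let $F_m=\sum_{k=0}^{n} f_{m+k}e_k\in A$, where $(f_j)$ is the Fibonacci sequence. Put $\alpha=\frac{1+\sqrt5}{2}$, $\beta=\frac{1-\sqrt5}{2}$, $\alpha^{\ast}=\sum_{k=0}^{n}\alpha^k e_k$ and $\beta^{\ast}=\sum_{k=0}^{n}\beta^k e_k$. Then for all $m\in\mathbb{N}$, $$F_m=\frac{\alpha^{\ast}\alpha^{m}-\beta^{\ast}\beta^{m}}{\alpha-\beta}.$$
   Context: The Fibonacci sequence is $f_0=0$, $f_1=1$, $f_j=f_{j-1}+f_{j-2}$ for $j\ge 2$. Here $\mathbb{N}=\{0,1,2,\dots\}$. The algebra $A$ is arbitrary with unit $e_0=1$: its multiplication is $K$-bilinear and is not assumed to be commutative or associative. The elements $F_m$ are called Fibonacci elements of $A$. In the formula, $\alpha,\beta$ are scalars in $K$ and $\alpha^{\ast},\beta^{\ast}$ are elements of $A$. *)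

theory Defs
  imports Complex_Main "HOL-Number_Theory.Fib"
begin

(* The class of 'a only supplies addition; the product is the parameter mult, so that
   neither associativity nor commutativity comes in through a type class. *)
locale unital_algebra = vector_space scale
  for scale :: "'k::field \<Rightarrow> 'a::ab_group_add \<Rightarrow> 'a" +
  fixes mult :: "'a \<Rightarrow> 'a \<Rightarrow> 'a"
    and unit_elt :: 'a
  assumes linear_mult_right: "Vector_Spaces.linear scale scale (\<lambda>y. mult x y)"
    and linear_mult_left: "Vector_Spaces.linear scale scale (\<lambda>x. mult x y)"
    and mult_unit_left: "mult unit_elt x = x"
    and mult_unit_right: "mult x unit_elt = x"

(* Only the values e 0, ..., e n matter; injectivity makes them n + 1 distinct vectors. *)
locale unital_algebra_with_basis = unital_algebra scale mult unit_elt
  for scale :: "'k::field \<Rightarrow> 'a::ab_group_add \<Rightarrow> 'a"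
    and mult :: "'a \<Rightarrow> 'a \<Rightarrow> 'a"
    and unit_elt :: 'a +
  fixes e :: "nat \<Rightarrow> 'a" and n :: nat
  assumes e_0: "e 0 = unit_elt"
    and inj_on_e: "inj_on e {0..n}"
    and independent_e: "independent (e ` {0..n})"
    and span_e: "span (e ` {0..n}) = UNIV"

definition fibonacci_element ::
    "('k::field \<Rightarrow> 'a::ab_group_add \<Rightarrow> 'a) \<Rightarrow> (nat \<Rightarrow> 'a) \<Rightarrow> nat \<Rightarrow> nat \<Rightarrow> 'a" where
  "fibonacci_element scale e n m = (\<Sum>k=0..n. scale (of_nat (fib (m + k))) (e k))"

(* star scale e n c is the element written c with a star, for c = alpha or c = beta. *)
definition star ::
    "('k::field \<Rightarrow> 'a::ab_group_add \<Rightarrow> 'a) \<Rightarrow> (nat \<Rightarrow> 'a) \<Rightarrow> nat \<Rightarrow> 'k \<Rightarrow> 'a" where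
  "star scale e n c = (\<Sum>k=0..n. scale (c ^ k) (e k))"

definition alpha :: "'k::real_field" where
  "alpha = (1 + of_real (sqrt 5)) / 2"

definition beta :: "'k::real_field" where
  "beta = (1 - of_real (sqrt 5)) / 2"

end

theory Submission imports Defs begin

text \<open>
  Binet's formula \<open>fib j = (\<alpha> ^ j - \<beta> ^ j) / (\<alpha> - \<beta>)\<close> holds in every field
  extending the reals (\<open>binet_real_field\<close>). Splitting
  \<open>\<alpha> ^ (m + k) = \<alpha> ^ m * \<alpha> ^ k\<close>, and likewise for \<open>\<beta>\<close>, the \<open>k\<close>-th coordinate of \<open>F\<^sub>m\<close> is the
  \<open>k\<close>-th coordinate of \<open>(\<alpha> ^ m \<alpha>* - \<beta> ^ m \<beta>*) / (\<alpha> - \<beta>)\<close>. The two sides are thus linear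
  combinations of the same family \<open>e\<close> with equal coefficients
  (\<open>fibonacci_element_binet_if_fib_binet\<close>).
\<close>

text \<open>
  Transporting the real closed form along \<open>of_real\<close> treats the real and the complex case at once.
\<close>

lemma binet_real_field:
  "(of_nat (fib j) :: 'k::real_field) = (alpha ^ j - beta ^ j) / (alpha - beta)"
proof -
  have diff: "(alpha - beta :: 'k) = of_real (sqrt 5)"
    by (simp add: alpha_def beta_def field_simps)
  have a: "(alpha :: 'k) = of_real ((1 + sqrt 5) / 2)"
    and b: "(beta :: 'k) = of_real ((1 - sqrt 5) / 2)"
    by (simp_all add: alpha_def beta_def)
  have "(of_nat (fib j) :: 'k) = of_real (real (fib j))"
    by simp
  also have "\<dots> = of_real ((((1 + sqrt 5) / 2) ^ j - ((1 - sqrt 5) / 2) ^ j) / sqrt 5)"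
    by (simp only: fib_closed_form)
  also have "\<dots> = (alpha ^ j - beta ^ j) / (alpha - beta)"
    unfolding diff unfolding a b by (simp only: of_real_divide of_real_diff of_real_power)
  finally show ?thesis .
qed

text \<open>
  Stated for abstract \<open>a\<close> and \<open>b\<close>: any scalars that express the Fibonacci numbers in Binet's form
  also express the Fibonacci elements in that form, one coordinate at a time.
\<close>

lemma (in vector_space) fibonacci_element_binet_if_fib_binet:
  assumes "\<And>j. (of_nat (fib j) :: 'a) = (a ^ j - b ^ j) / (a - b)"
  shows "fibonacci_element scale e n m =
    scale (1 / (a - b)) (scale (a ^ m) (star scale e n a) - scale (b ^ m) (star scale e n b))"
  by (simp add: fibonacci_element_def star_def assms scale_sum_right scale_right_diff_distrib
      scale_left_diff_distrib diff_divide_distrib power_add sum_subtractf)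

theorem proposition2p3:
  "(\<forall>(scale :: real \<Rightarrow> 'a::ab_group_add \<Rightarrow> 'a) mult unit_elt e n.
      unital_algebra_with_basis scale mult unit_elt e n \<longrightarrow>
      (\<forall>m. fibonacci_element scale e n m =
        scale (1 / (alpha - beta))
          (scale (alpha ^ m) (star scale e n alpha) - scale (beta ^ m) (star scale e n beta))))
   \<and>
   (\<forall>(scale :: complex \<Rightarrow> 'b::ab_group_add \<Rightarrow> 'b) mult unit_elt e n.
      unital_algebra_with_basis scale mult unit_elt e n \<longrightarrow>
      (\<forall>m. fibonacci_element scale e n m =
        scale (1 / (alpha - beta))
          (scale (alpha ^ m) (star scale e n alpha) - scale (beta ^ m) (star scale e n beta))))"
proof (intro conjI allI impI)
  fix scale :: "real \<Rightarrow> 'a \<Rightarrow> 'a" and mult unit_elt e n m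
  assume "unital_algebra_with_basis scale mult unit_elt e n"
  then interpret unital_algebra_with_basis scale mult unit_elt e n .
  show "fibonacci_element scale e n m =
      scale (1 / (alpha - beta))
        (scale (alpha ^ m) (star scale e n alpha) - scale (beta ^ m) (star scale e n beta))"
    by (rule fibonacci_element_binet_if_fib_binet[OF binet_real_field])
next
  fix scale :: "complex \<Rightarrow> 'b \<Rightarrow> 'b" and mult unit_elt e n m
  assume "unital_algebra_with_basis scale mult unit_elt e n"
  then interpret unital_algebra_with_basis scale mult unit_elt e n .
  show "fibonacci_element scale e n m =
      scale (1 / (alpha - beta))
        (scale (alpha ^ m) (star scale e n alpha) - scale (beta ^ m) (star scale e n beta))"
    by (rule fibonacci_element_binet_if_fib_binet[OF binet_real_field])
qed

end
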